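(* For every $p$ with $\frac12<p<1$, the mutually excited random walk with parameter $p$ is transient; that is, both processes $\{X_n\}$ and $\{Y_n\}$ are transient.
   Context: The mutually excited random walk (MERW) with parameter $p$ is a pair of $\mathbb{Z}$-valued processes $(X_n,Y_n)_{n\ge 0}$ with $X_0=Y_0=0$. Let $\mathcal{F}_n=\sigma(X_0,\dots,X_n,Y_0,\dots,Y_n)$. Set $w(0)=w(1)=\frac12$ and $w(j)=p$ for all integers $j\ge 2$. Conditionally on $\mathcal{F}_n$, the steps $X_{n+1}-X_n$ and $Y_{n+1}-Y_n$ are independent, take values in $\{-1,+1\}$, and satisfy $$\mathbf{P}[X_{n+1}=X_n+1\mid\mathcal{F}_n]=w\big(\#\{0\le m\le n:Y_m=X_n\}\big),\qquad \mathbf{P}[Y_{n+1}=Y_n+1\mid\mathcal{F}_n]=w\big(\#\{0\le m\le n:X_m=Y_n\}\big).$$ A $\mathbb{Z}$-valued process $\{\xi_n\}$ is transient if $\mathbf{P}(\forall z\in\mathbb{Z}\ \exists n\ \forall m>n:\ \xi_m\ne z)=1$. *)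

theory Defs
  imports "HOL-Probability.Probability"
begin

definition merw_weight :: "real \<Rightarrow> nat \<Rightarrow> real" where
  "merw_weight p j = (if j \<le> 1 then 1 / 2 else p)"

text \<open>The sigma-algebra generated by \<open>X 0, \<dots>, X n, Y 0, \<dots>, Y n\<close>, as a measure
  space whose measure is irrelevant, which is how \<^const>\<open>real_cond_exp\<close> expects it.\<close>

definition natural_sigma ::
    "'a measure \<Rightarrow> (nat \<Rightarrow> 'a \<Rightarrow> int) \<Rightarrow> (nat \<Rightarrow> 'a \<Rightarrow> int) \<Rightarrow> nat \<Rightarrow> 'a measure" where
  "natural_sigma M X Y n = sigma (space M)
     ({X m -` A \<inter> space M | m A. m \<le> n} \<union> {Y m -` A \<inter> space M | m A. m \<le> n})"

text \<open>A version of the conditional probability of the event \<open>P\<close> given the sigma-algebra \<open>F\<close>;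
  meaningful up to null sets only.\<close>

definition prob_given :: "'a measure \<Rightarrow> 'a measure \<Rightarrow> ('a \<Rightarrow> bool) \<Rightarrow> 'a \<Rightarrow> real" where
  "prob_given M F P = real_cond_exp M F (indicator {\<omega> \<in> space M. P \<omega>})"

locale mutually_excited_random_walk = prob_space M
  for M :: "'a measure" and p :: real and X Y :: "nat \<Rightarrow> 'a \<Rightarrow> int" +
  assumes X_measurable: "\<And>n. X n \<in> measurable M (count_space UNIV)"
    and Y_measurable: "\<And>n. Y n \<in> measurable M (count_space UNIV)"
    and start: "AE \<omega> in M. X 0 \<omega> = 0 \<and> Y 0 \<omega> = 0"
    and X_step: "\<And>n. AE \<omega> in M. X (Suc n) \<omega> - X n \<omega> \<in> {-1, 1}"
    and Y_step: "\<And>n. AE \<omega> in M. Y (Suc n) \<omega> - Y n \<omega> \<in> {-1, 1}"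
    and X_up: "\<And>n. AE \<omega> in M.
      prob_given M (natural_sigma M X Y n) (\<lambda>\<omega>. X (Suc n) \<omega> = X n \<omega> + 1) \<omega>
        = merw_weight p (card {m. m \<le> n \<and> Y m \<omega> = X n \<omega>})"
    and Y_up: "\<And>n. AE \<omega> in M.
      prob_given M (natural_sigma M X Y n) (\<lambda>\<omega>. Y (Suc n) \<omega> = Y n \<omega> + 1) \<omega>
        = merw_weight p (card {m. m \<le> n \<and> X m \<omega> = Y n \<omega>})"
    and steps_cond_indep: "\<And>n A B. AE \<omega> in M.
      prob_given M (natural_sigma M X Y n)
          (\<lambda>\<omega>. X (Suc n) \<omega> - X n \<omega> \<in> A \<and> Y (Suc n) \<omega> - Y n \<omega> \<in> B) \<omega>
        = prob_given M (natural_sigma M X Y n) (\<lambda>\<omega>. X (Suc n) \<omega> - X n \<omega> \<in> A) \<omega>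
          * prob_given M (natural_sigma M X Y n) (\<lambda>\<omega>. Y (Suc n) \<omega> - Y n \<omega> \<in> B) \<omega>"

text \<open>\<^const>\<open>real_cond_exp\<close> is a default value unless the following holds.\<close>

lemma (in mutually_excited_random_walk) subalgebra_natural_sigma:
  "subalgebra M (natural_sigma M X Y n)"
proof -
  let ?G = "{X m -` A \<inter> space M | m A. m \<le> n} \<union> {Y m -` A \<inter> space M | m A. m \<le> n}"
  have "?G \<subseteq> sets M"
    using measurable_sets[OF X_measurable] measurable_sets[OF Y_measurable] by auto
  moreover have "?G \<subseteq> Pow (space M)" by auto
  ultimately show ?thesis
    unfolding subalgebra_def natural_sigma_def
    by (simp add: space_measure_of sets_measure_of sets.sigma_sets_subset)
qed

definition transient :: "'a measure \<Rightarrow> (nat \<Rightarrow> 'a \<Rightarrow> int) \<Rightarrow> bool" where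
  "transient M \<xi> \<longleftrightarrow>
     measure M {\<omega> \<in> space M. \<forall>z. \<exists>n. \<forall>m>n. \<xi> m \<omega> \<noteq> z} = 1"

end

theory Submission
  imports Defs
begin

text \<open>
  Both walks are submartingales, so by a polynomially large time \<open>T\<close> each has reached a large
  site \<open>l\<close> with high probability. Whenever \<open>Y\<close> reaches a new maximum it steps left with
  probability at least \<open>1 - p\<close>, and must then pass the maximal site a second time; hence many
  sites of \<open>[0, l)\<close> have been visited twice by \<open>Y\<close>, namely enough to make the expectation of
  \<open>((1 - p) / p)\<close> to the power of their number exponentially small in \<open>l\<close>. At these sites \<open>X\<close> is biased
  to the right, so each return of \<open>X\<close> to \<open>l\<close> leads back to a fixed site \<open>K\<close> only
  with exponentially small probability, and \<open>X\<close> stays above \<open>K\<close> until both walks have reached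
  the much larger site \<open>l\<^sup>3\<close>. Borel--Cantelli along the scales \<open>l = 2 ^ 3 ^ k\<close> shows that
  \<open>X\<close> tends to infinity. The situation is symmetric in \<open>X\<close> and \<open>Y\<close>.
\<close>

section \<open>Potentials on deterministic paths\<close>

definition visits :: "(nat \<Rightarrow> int) \<Rightarrow> nat \<Rightarrow> int \<Rightarrow> nat" where
  "visits y n j = card {m. m \<le> n \<and> y m = j}"

definition top_site :: "(nat \<Rightarrow> int) \<Rightarrow> nat \<Rightarrow> int" where
  "top_site y n = Max (y ` {..n})"

definition revisited :: "(nat \<Rightarrow> int) \<Rightarrow> nat \<Rightarrow> int \<Rightarrow> int set" where
  "revisited y n l = {j. 0 \<le> j \<and> j < l \<and> 2 \<le> visits y n j}"

text \<open>A fresh path stands at its maximum for the first time; at the next step it is decided whether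
  this site will be passed again. A settled maximum counts as revisited in advance.\<close>

definition fresh :: "int \<Rightarrow> (nat \<Rightarrow> int) \<Rightarrow> nat \<Rightarrow> bool" where
  "fresh l y n \<longleftrightarrow> top_site y n < l \<and> y n = top_site y n \<and> visits y n (y n) < 2"

definition settled :: "int \<Rightarrow> (nat \<Rightarrow> int) \<Rightarrow> nat \<Rightarrow> nat" where
  "settled l y n = of_bool (top_site y n < l \<and> \<not> fresh l y n)"

text \<open>A supermartingale for \<open>b = p + (1 - p) * r\<close>: it changes only when the path is fresh, by at
  most the factor \<open>1 / b\<close> on a right step and \<open>r / b\<close> on a left step.\<close>

definition revisit_potential :: "real \<Rightarrow> real \<Rightarrow> int \<Rightarrow> (nat \<Rightarrow> int) \<Rightarrow> nat \<Rightarrow> real" where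
  "revisit_potential r b l y n =
     r ^ (card (revisited y n (min (top_site y n) l)) + settled l y n) /
     b ^ (nat (min (top_site y n) l) + settled l y n)"

lemma visits_Suc: "visits y (Suc n) j = visits y n j + of_bool (y (Suc n) = j)"
proof -
  have "{m. m \<le> Suc n \<and> y m = j} =
      (if y (Suc n) = j then insert (Suc n) {m. m \<le> n \<and> y m = j} else {m. m \<le> n \<and> y m = j})"
    by (auto simp: le_Suc_eq)
  then show ?thesis
    by (simp add: visits_def)
qed

lemma visits_mono: "n \<le> n' \<Longrightarrow> visits y n j \<le> visits y n' j"
  unfolding visits_def by (rule card_mono) auto

lemma visits_cong: "(\<And>m. m \<le> n \<Longrightarrow> y m = y' m) \<Longrightarrow> visits y n j = visits y' n j"
  unfolding visits_def by (rule arg_cong[where f = card]) auto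

lemma top_site_Suc: "top_site y (Suc n) = max (top_site y n) (y (Suc n))"
  by (simp add: top_site_def atMost_Suc max.commute)

lemma le_top_site: "m \<le> n \<Longrightarrow> y m \<le> top_site y n"
  by (simp add: top_site_def)

lemma top_site_cong: "(\<And>m. m \<le> n \<Longrightarrow> y m = y' m) \<Longrightarrow> top_site y n = top_site y' n"
  unfolding top_site_def by (rule arg_cong[where f = Max]) auto

lemma top_site_ge_iff: "l \<le> top_site y n \<longleftrightarrow> (\<exists>m\<le>n. l \<le> y m)"
  by (auto simp: top_site_def Max_ge_iff)

lemma visits_top_site: "1 \<le> visits y n (top_site y n)"
proof -
  have "top_site y n \<in> y ` {..n}"
    unfolding top_site_def by (rule Max_in) auto
  then have "{m. m \<le> n \<and> y m = top_site y n} \<noteq> {}" by auto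
  then show ?thesis
    unfolding visits_def by (simp add: Suc_le_eq card_gt_0_iff)
qed

lemma visits_above_top_site: "top_site y n < j \<Longrightarrow> visits y n j = 0"
  unfolding visits_def using le_top_site[of _ n y] by (fastforce simp: card_eq_0_iff)

lemma finite_revisited [simp]: "finite (revisited y n l)"
  by (rule finite_subset[of _ "{0..<l}"]) (auto simp: revisited_def)

lemma card_revisited_mono:
  "n \<le> n' \<Longrightarrow> l \<le> l' \<Longrightarrow> card (revisited y n l) \<le> card (revisited y n' l')"
  by (rule card_mono[OF finite_revisited])
    (auto simp: revisited_def intro: order_trans[OF _ visits_mono])

lemma revisit_potential_cong:
  assumes "\<And>m. m \<le> n \<Longrightarrow> y m = y' m"
  shows "revisit_potential r b l y n = revisit_potential r b l y' n"
    and "fresh l y n = fresh l y' n"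
    and "revisited y n l = revisited y' n l"
proof -
  have *: "visits y n = visits y' n" "top_site y n = top_site y' n" "y n = y' n"
    using assms visits_cong[of n y y'] top_site_cong[of n y y'] by auto
  show "fresh l y n = fresh l y' n" by (simp add: fresh_def *)
  show "revisited y n l = revisited y' n l" by (simp add: revisited_def *)
  show "revisit_potential r b l y n = revisit_potential r b l y' n"
    by (simp add: revisit_potential_def settled_def revisited_def fresh_def *)
qed

lemma revisit_potential_nonneg: "0 \<le> r \<Longrightarrow> 0 \<le> b \<Longrightarrow> 0 \<le> revisit_potential r b l y n"
  by (simp add: revisit_potential_def)

text \<open>A coarse bound, used for integrability.\<close>

lemma revisit_potential_le:
  assumes "0 \<le> r" "r \<le> 1" "0 < b" "b \<le> 1"
  shows "revisit_potential r b l y n \<le> 1 / b ^ Suc (nat l)"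
proof -
  have "nat (min (top_site y n) l) + settled l y n \<le> Suc (nat l)"
    by (auto simp: settled_def)
  then have "b ^ Suc (nat l) \<le> b ^ (nat (min (top_site y n) l) + settled l y n)"
    using assms by (intro power_decreasing) auto
  then show ?thesis
    unfolding revisit_potential_def using assms
    by (intro frac_le) (auto simp: power_le_one)
qed

lemma power_div_power_mono:
  fixes r b :: real
  assumes "0 \<le> r" "r \<le> 1" "0 < b" "i \<le> j"
  shows "r ^ j / b ^ n \<le> r ^ i / b ^ n"
  using assms by (intro divide_right_mono power_decreasing) auto

text \<open>Each maximal site below \<open>l\<close> costs one factor \<open>1 / b\<close>, at the
  moment when the path leaves it as a fresh maximum; a left step then earns \<open>r\<close> in
  advance. Later revisits can only lower the potential, as \<open>r\<close> is at most 1. Once the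
  maximum reaches \<open>l\<close>, the exponent of \<open>b\<close> is frozen.\<close>

lemma revisit_potential_Suc:
  assumes r: "0 \<le> r" "r \<le> 1" and b: "0 < b" and y0: "y 0 = 0"
    and step: "y (Suc n) = y n + 1 \<or> y (Suc n) = y n - 1"
  shows "revisit_potential r b l y (Suc n) \<le>
    (if \<not> fresh l y n then 1 else if y (Suc n) = y n + 1 then 1 / b else r / b)
      * revisit_potential r b l y n"
proof -
  define t where "t = top_site y n"
  define R where "R = revisited y n"
  have t0: "0 \<le> t" using le_top_site[of 0 n y] y0 by (simp add: t_def)
  have yt: "y n \<le> t" by (simp add: t_def le_top_site)
  have mono: "card (R i) \<le> card (revisited y (Suc n) j)" if "i \<le> j" for i j
    unfolding R_def using that by (intro card_revisited_mono) auto
  have pow: "r ^ j / b ^ m \<le> r ^ i / b ^ m" if "i \<le> j" for i j m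
    using power_div_power_mono r b that by blast
  have up: "top_site y (Suc n) = t + 1" "settled l y (Suc n) = 0" "min (t + 1) l = t + 1"
      "nat (t + 1) = Suc (nat t)"
    if "y n = t" "y (Suc n) = y n + 1" "t < l"
  proof -
    show "top_site y (Suc n) = t + 1"
      using that by (simp add: top_site_Suc flip: t_def)
    moreover have "visits y (Suc n) (t + 1) < 2"
      using that visits_above_top_site[of y n "t + 1"] by (simp add: visits_Suc t_def)
    ultimately show "settled l y (Suc n) = 0"
      using that by (simp add: settled_def fresh_def)
  qed (use that t0 in auto)
  have stay: "top_site y (Suc n) = t" "settled l y (Suc n) = 1"
    if "y (Suc n) \<le> t" "t < l"
  proof -
    show t': "top_site y (Suc n) = t"
      using that by (simp add: top_site_Suc flip: t_def)
    have "2 \<le> visits y (Suc n) t" if "y (Suc n) = t"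
      using visits_top_site[of y n] that by (simp add: visits_Suc flip: t_def)
    then show "settled l y (Suc n) = 1"
      using \<open>t < l\<close> t' by (auto simp: settled_def fresh_def)
  qed
  have settled_now: "settled l y n = of_bool (\<not> fresh l y n)" if "t < l"
    using that by (simp add: settled_def t_def)
  consider "l \<le> t" | "t < l" "fresh l y n" "y (Suc n) = y n + 1"
    | "t < l" "fresh l y n" "y (Suc n) = y n - 1"
    | "t < l" "\<not> fresh l y n" "y n = t" "y (Suc n) = y n + 1"
    | "t < l" "\<not> fresh l y n" "y (Suc n) \<le> t"
    using step yt by force
  then show ?thesis
  proof cases
    case 1
    then have "l \<le> top_site y (Suc n)" "\<not> fresh l y n"
      by (auto simp: top_site_Suc t_def fresh_def)
    then show ?thesis
      using 1 pow[OF mono[of l l]]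
      by (simp add: revisit_potential_def settled_def fresh_def R_def min_absorb2 flip: t_def)
  next
    case 2
    then have "y n = t" by (simp add: fresh_def t_def)
    then show ?thesis
      using 2 up pow[OF mono[of t "t + 1"], of "Suc (nat t)"]
      by (simp add: revisit_potential_def settled_now R_def flip: t_def)
  next
    case 3
    then have "y n = t" by (simp add: fresh_def t_def)
    then have "y (Suc n) \<le> t" using 3 by simp
    then show ?thesis
      using 3 stay pow[of "Suc (card (R t))" "Suc (card (revisited y (Suc n) t))" "Suc (nat t)"]
        mono[of t t]
      by (simp add: revisit_potential_def settled_now R_def flip: t_def)
  next
    case 4
    \<comment> \<open>Standing at the maximum without being fresh means a second visit. When the
      path moves on, the credit held in \<open>settled\<close> turns into the element
      \<open>t\<close> of \<open>revisited\<close>, so both exponents balance.\<close>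
    then have "2 \<le> visits y n t" by (auto simp: fresh_def t_def)
    then have "insert t (R t) \<subseteq> revisited y (Suc n) (t + 1)"
      using t0 by (auto simp: R_def revisited_def visits_Suc)
    then have "card (insert t (R t)) \<le> card (revisited y (Suc n) (t + 1))"
      by (intro card_mono) auto
    moreover have "t \<notin> R t" "finite (R t)" by (simp_all add: R_def) (simp add: revisited_def)
    ultimately have "Suc (card (R t)) \<le> card (revisited y (Suc n) (t + 1))"
      by simp
    then show ?thesis
      using 4 up pow[of "Suc (card (R t))" "card (revisited y (Suc n) (t + 1))" "Suc (nat t)"]
      by (simp add: revisit_potential_def settled_now R_def flip: t_def)
  next
    case 5
    then show ?thesis
      using stay pow[of "Suc (card (R t))" "Suc (card (revisited y (Suc n) t))" "Suc (nat t)"]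
        mono[of t t]
      by (simp add: revisit_potential_def settled_now R_def flip: t_def)
  qed
qed

text \<open>Up to a factor, the probability that a walk from \<open>x\<close>, unbiased off \<open>D\<close> and with ratio \<open>r\<close> of left
  to right steps on \<open>D\<close>, hits \<open>K\<close> before \<open>l\<close>.\<close>

definition escape_potential :: "real \<Rightarrow> int set \<Rightarrow> int \<Rightarrow> int \<Rightarrow> int \<Rightarrow> real" where
  "escape_potential r D K l x = (\<Sum>j\<in>{max K x..<l}. r ^ card (D \<inter> {..j}))"

lemma escape_potential_nonneg: "0 \<le> r \<Longrightarrow> 0 \<le> escape_potential r D K l x"
  unfolding escape_potential_def by (intro sum_nonneg) auto

lemma escape_potential_le:
  assumes "0 \<le> r" "r \<le> 1"
  shows "escape_potential r D K l x \<le> real (nat (l - K))"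
proof -
  have "escape_potential r D K l x \<le> (\<Sum>j\<in>{max K x..<l}. 1)"
    unfolding escape_potential_def using assms by (intro sum_mono) (simp add: power_le_one)
  also have "\<dots> \<le> real (nat (l - K))" by (simp add: nat_mono)
  finally show ?thesis .
qed

lemma escape_potential_eq_0: "l \<le> x \<Longrightarrow> escape_potential r D K l x = 0"
  by (simp add: escape_potential_def)

lemma escape_potential_below: "x \<le> K \<Longrightarrow> escape_potential r D K l x = escape_potential r D K l K"
  by (simp add: escape_potential_def max_def)

lemma escape_potential_rec:
  assumes "K \<le> x" "x < l"
  shows "escape_potential r D K l x = r ^ card (D \<inter> {..x}) + escape_potential r D K l (x + 1)"
proof -
  have "{x..<l} = insert x {x + 1..<l}" using assms by auto
  then show ?thesis using assms by (simp add: escape_potential_def max_absorb2)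
qed

text \<open>The summand at \<open>K\<close> alone suffices, since \<open>D\<close> has at most
  \<open>K + 1\<close> points up to \<open>K\<close>. The bound is uniform in \<open>D\<close>,
  which will be random.\<close>

lemma escape_potential_barrier:
  assumes r: "0 \<le> r" "r \<le> 1" and "0 \<le> K" "K < l" "D \<subseteq> {0..}"
  shows "r ^ nat (K + 1) \<le> escape_potential r D K l K"
proof -
  have "card (D \<inter> {..K}) \<le> card {0..K}"
    using assms by (intro card_mono) auto
  then have "r ^ nat (K + 1) \<le> r ^ card (D \<inter> {..K})"
    using assms by (intro power_decreasing) auto
  then show ?thesis
    using escape_potential_rec[of K K l r D] escape_potential_nonneg[OF r(1), of D K l "K + 1"] assms
    by simp
qed

text \<open>From \<open>x < l\<close> a right step removes
  \<open>r ^ card (D \<inter> {..x})\<close> and a left step adds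
  \<open>r ^ card (D \<inter> {..x - 1})\<close>. On \<open>D\<close> these differ by the factor
  \<open>r\<close>, which balances the bias; off \<open>D\<close> they agree and
  \<open>1 / 2 \<le> q\<close> is enough. At \<open>l\<close> a left step adds the full last
  summand, whence the error \<open>r ^ card D\<close>; above \<open>l\<close> everything
  vanishes.\<close>

lemma escape_potential_drift:
  assumes r: "0 \<le> r" "r \<le> 1" and D: "D \<subseteq> {0..<l}" and K: "K < l" "K < x"
    and q: "1 / 2 \<le> q" "q \<le> 1" "x \<in> D \<Longrightarrow> 1 - q \<le> q * r"
  shows "q * escape_potential r D K l (x + 1) + (1 - q) * escape_potential r D K l (x - 1)
    \<le> escape_potential r D K l x + r ^ card D"
proof -
  let ?\<phi> = "escape_potential r D K l"
  have fin: "finite D" using D finite_subset by blast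
  consider "l < x" | "x = l" | "x < l" by linarith
  then show ?thesis
  proof cases
    case 1
    then show ?thesis using r by (simp add: escape_potential_eq_0)
  next
    case 2
    have "D \<inter> {..l - 1} = D" using D by auto
    then have "?\<phi> (l - 1) = r ^ card D"
      using escape_potential_rec[of K "l - 1" l r D] K by (simp add: escape_potential_eq_0)
    moreover have "(1 - q) * r ^ card D \<le> 1 * r ^ card D"
      using q r by (intro mult_right_mono) auto
    ultimately show ?thesis using 2 by (simp add: escape_potential_eq_0)
  next
    case 3
    let ?c = "\<lambda>x. card (D \<inter> {..x})"
    have 1: "?\<phi> x = r ^ ?c x + ?\<phi> (x + 1)" using escape_potential_rec K 3 by simp
    have 2: "?\<phi> (x - 1) = r ^ ?c (x - 1) + ?\<phi> x"
      using escape_potential_rec[of K "x - 1"] K 3 by simp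
    have "(1 - q) * r ^ ?c (x - 1) \<le> q * r ^ ?c x"
    proof (cases "x \<in> D")
      case True
      then have "D \<inter> {..x} = insert x (D \<inter> {..x - 1})" by auto
      then have "?c x = Suc (?c (x - 1))" using fin by simp
      then show ?thesis
        using mult_right_mono[OF q(3)[OF True], of "r ^ ?c (x - 1)"] r by (simp add: mult_ac)
    next
      case False
      then have "D \<inter> {..x} = D \<inter> {..x - 1}" by (auto simp: order_le_less)
      then have "?c x = ?c (x - 1)" by (rule arg_cong)
      moreover have "(1 - q) * r ^ ?c (x - 1) \<le> q * r ^ ?c (x - 1)"
        using q r by (intro mult_right_mono) auto
      ultimately show ?thesis by (simp only:)
    qed
    moreover have "0 \<le> r ^ card D" using r by simp
    ultimately show ?thesis unfolding 2 1 by (simp add: algebra_simps)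
  qed
qed

section \<open>The probability space\<close>

locale right_biased_merw = mutually_excited_random_walk M p X Y
  for M :: "'a measure" and p :: real and X Y :: "nat \<Rightarrow> 'a \<Rightarrow> int" +
  assumes half_less_p: "1 / 2 < p" and p_less_1: "p < 1"
begin

section \<open>Functions of the history and one-step expectations\<close>

definition up_prob :: "nat \<Rightarrow> 'a \<Rightarrow> real" where
  "up_prob n \<omega> = merw_weight p (visits (\<lambda>m. Y m \<omega>) n (X n \<omega>))"

text \<open>Adaptedness in pointwise form, as dependence on the history alone; measurability follows
  because there are only countably many histories.\<close>

definition determined :: "nat \<Rightarrow> ('a \<Rightarrow> 'b) \<Rightarrow> bool" where
  "determined n Z \<longleftrightarrow> (\<forall>\<omega> \<omega>'. (\<forall>m\<le>n. X m \<omega> = X m \<omega>' \<and> Y m \<omega> = Y m \<omega>') \<longrightarrow> Z \<omega> = Z \<omega>')"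

lemma determinedI:
  "(\<And>\<omega> \<omega>'. (\<And>m. m \<le> n \<Longrightarrow> X m \<omega> = X m \<omega>') \<Longrightarrow> (\<And>m. m \<le> n \<Longrightarrow> Y m \<omega> = Y m \<omega>') \<Longrightarrow> Z \<omega> = Z \<omega>')
    \<Longrightarrow> determined n Z"
  unfolding determined_def by blast

lemma determinedD:
  "determined n Z \<Longrightarrow> (\<And>m. m \<le> n \<Longrightarrow> X m \<omega> = X m \<omega>') \<Longrightarrow> (\<And>m. m \<le> n \<Longrightarrow> Y m \<omega> = Y m \<omega>') \<Longrightarrow> Z \<omega> = Z \<omega>'"
  unfolding determined_def by blast

lemma up_prob_bounds: "1 / 2 \<le> up_prob n \<omega>" "up_prob n \<omega> \<le> p"
  using half_less_p by (auto simp: up_prob_def merw_weight_def)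

lemma up_prob_revisited: "2 \<le> visits (\<lambda>m. Y m \<omega>) n (X n \<omega>) \<Longrightarrow> up_prob n \<omega> = p"
  by (auto simp: up_prob_def merw_weight_def)

lemma determined_up_prob: "determined n (up_prob n)"
proof (rule determinedI)
  fix \<omega> \<omega>' assume "\<And>m. m \<le> n \<Longrightarrow> X m \<omega> = X m \<omega>'" "\<And>m. m \<le> n \<Longrightarrow> Y m \<omega> = Y m \<omega>'"
  then show "up_prob n \<omega> = up_prob n \<omega>'"
    using visits_cong[of n "\<lambda>m. Y m \<omega>" "\<lambda>m. Y m \<omega>'"] by (simp add: up_prob_def)
qed

lemma space_natural_sigma [simp]: "space (natural_sigma M X Y n) = space M"
  using subalgebra_natural_sigma by (simp add: subalgebra_def)

lemma determined_measurable:
  assumes "determined n Z" "Z ` space M \<subseteq> space N"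
  shows "Z \<in> measurable (natural_sigma M X Y n) N"
proof -
  let ?F = "natural_sigma M X Y n"
  \<comment> \<open>Histories form a countable type, so every function of the history is measurable.\<close>
  define hist where "hist \<omega> = map (\<lambda>m. (X m \<omega>, Y m \<omega>)) [0..<Suc n]" for \<omega>
  have gens: "sets ?F = sigma_sets (space M)
      ({X m -` A \<inter> space M | m A. m \<le> n} \<union> {Y m -` A \<inter> space M | m A. m \<le> n})"
    unfolding natural_sigma_def by (rule sets_measure_of) auto
  have XY: "X m -` A \<inter> space M \<in> sets ?F" "Y m -` A \<inter> space M \<in> sets ?F" if "m \<le> n" for m A
    unfolding gens using that by (blast intro: sigma_sets.Basic)+
  have hist_eq: "hist \<omega> = hist \<omega>' \<longleftrightarrow> (\<forall>m\<le>n. X m \<omega> = X m \<omega>' \<and> Y m \<omega> = Y m \<omega>')" for \<omega> \<omega>'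
    by (auto simp: hist_def simp del: upt_Suc)
  have "hist -` {h} \<inter> space M \<in> sets ?F" for h
  proof (cases "\<exists>\<omega>'. h = hist \<omega>'")
    case True
    then obtain \<omega>' where h: "h = hist \<omega>'" by blast
    have "hist -` {h} \<inter> space M =
      (\<Inter>m\<in>{..n}. (X m -` {X m \<omega>'} \<inter> space M) \<inter> (Y m -` {Y m \<omega>'} \<inter> space M))"
      unfolding h by (auto simp: hist_eq)
    also have "\<dots> \<in> sets ?F"
    proof (rule sets.finite_INT)
      show "(X m -` {X m \<omega>'} \<inter> space M) \<inter> (Y m -` {Y m \<omega>'} \<inter> space M) \<in> sets ?F"
        if "m \<in> {..n}" for m
        using that by (intro sets.Int XY) auto
    qed auto
    finally show ?thesis .
  next
    case False
    then have "hist -` {h} \<inter> space M = {}" by blast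
    then show ?thesis by simp
  qed
  then have hist: "hist \<in> measurable ?F (count_space UNIV)"
    by (subst measurable_count_space_eq2_countable) auto
  \<comment> \<open>\<open>g\<close> factors \<open>Z\<close> through the history. Any sample point
    with the given history can represent it, because \<open>Z\<close> is determined.\<close>
  define g where "g h = Z (SOME \<omega>. \<omega> \<in> space M \<and> hist \<omega> = h)" for h
  have g: "g (hist \<omega>) = Z \<omega> \<and> (SOME \<omega>'. \<omega>' \<in> space M \<and> hist \<omega>' = hist \<omega>) \<in> space M"
    if "\<omega> \<in> space M" for \<omega>
  proof -
    have *: "(SOME \<omega>'. \<omega>' \<in> space M \<and> hist \<omega>' = hist \<omega>) \<in> space M \<and>
        hist (SOME \<omega>'. \<omega>' \<in> space M \<and> hist \<omega>' = hist \<omega>) = hist \<omega>"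
      by (rule someI_ex) (use that in blast)
    then show ?thesis
      unfolding g_def using assms(1) unfolding determined_def hist_eq by blast
  qed
  show ?thesis
  proof (rule measurableI)
    fix A assume "A \<in> sets N"
    have "Z -` A \<inter> space ?F = hist -` (g -` A) \<inter> space ?F"
      using g by auto
    also have "\<dots> \<in> sets ?F"
      by (rule measurable_sets[OF hist]) simp
    finally show "Z -` A \<inter> space ?F \<in> sets ?F" .
  qed (use assms(2) in auto)
qed

lemma determined_measurable_M:
  fixes Z :: "'a \<Rightarrow> real"
  assumes "determined n Z"
  shows "Z \<in> borel_measurable M"
  by (rule measurable_from_subalg[OF subalgebra_natural_sigma determined_measurable[OF assms]]) simp

lemma determined_event:
  assumes "determined n P"
  shows "{\<omega> \<in> space M. P \<omega>} \<in> sets M"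
proof -
  have "P \<in> measurable M (count_space UNIV)"
    by (rule measurable_from_subalg[OF subalgebra_natural_sigma determined_measurable[OF assms]]) simp
  then show ?thesis by measurable
qed

lemma determined_integrable:
  fixes Z :: "'a \<Rightarrow> real"
  assumes "determined n Z" "\<And>\<omega>. \<bar>Z \<omega>\<bar> \<le> B"
  shows "integrable M Z"
  using assms(2) determined_measurable_M[OF assms(1)] by (intro integrable_const_bound[of _ B]) auto

text \<open>With \<open>D = Z1 - Z2\<close> the integrand is \<open>D\<close> times the indicator of
  a right step, plus \<open>Z2\<close>. As \<open>D\<close> depends on the history only, the
  indicator may be replaced by its conditional expectation, which \<open>X_up\<close> identifies
  with \<open>up_prob\<close>.\<close>

lemma expectation_step:
  fixes Z1 Z2 :: "'a \<Rightarrow> real"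
  assumes Z: "determined n Z1" "determined n Z2" "\<And>\<omega>. \<bar>Z1 \<omega>\<bar> \<le> B" "\<And>\<omega>. \<bar>Z2 \<omega>\<bar> \<le> B"
  shows "expectation (\<lambda>\<omega>. if X (Suc n) \<omega> = X n \<omega> + 1 then Z1 \<omega> else Z2 \<omega>) =
    expectation (\<lambda>\<omega>. up_prob n \<omega> * Z1 \<omega> + (1 - up_prob n \<omega>) * Z2 \<omega>)"
proof -
  let ?F = "natural_sigma M X Y n"
  let ?U = "{\<omega> \<in> space M. X (Suc n) \<omega> = X n \<omega> + 1}"
  interpret F: finite_measure_subalgebra M ?F
    by standard (rule subalgebra_natural_sigma)
  note [measurable] = X_measurable Y_measurable
  have U: "?U \<in> sets M" by measurable
  define D where "D \<omega> = Z1 \<omega> - Z2 \<omega>" for \<omega>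
  have D: "determined n D"
    using Z(1,2) unfolding determined_def D_def by metis
  have DB: "\<bar>D \<omega>\<bar> \<le> 2 * B" for \<omega>
    using Z(3,4)[of \<omega>] by (simp add: D_def)
  have intD: "integrable M D" by (rule determined_integrable[OF D DB])
  have intZ2: "integrable M Z2" by (rule determined_integrable[OF Z(2,4)])
  have intDU: "integrable M (\<lambda>\<omega>. D \<omega> * indicator ?U \<omega>)"
    using integrable_real_mult_indicator[OF U intD] .
  have intDw: "integrable M (\<lambda>\<omega>. D \<omega> * up_prob n \<omega>)"
  proof (rule determined_integrable)
    show "determined n (\<lambda>\<omega>. D \<omega> * up_prob n \<omega>)"
      using D determined_up_prob unfolding determined_def by metis
    have "\<bar>up_prob n \<omega>\<bar> \<le> 1" for \<omega>
      using up_prob_bounds[of n \<omega>] p_less_1 by auto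
    then show "\<bar>D \<omega> * up_prob n \<omega>\<bar> \<le> (2 * B) * 1" for \<omega>
      using DB[of \<omega>] unfolding abs_mult by (intro mult_mono) (auto intro: order_trans[OF abs_ge_zero])
  qed
  have "AE \<omega> in M. D \<omega> * real_cond_exp M ?F (indicator ?U) \<omega> = D \<omega> * up_prob n \<omega>"
    using X_up[of n] by (auto simp: prob_given_def up_prob_def visits_def)
  then have "expectation (\<lambda>\<omega>. D \<omega> * up_prob n \<omega>) =
      expectation (\<lambda>\<omega>. D \<omega> * real_cond_exp M ?F (indicator ?U) \<omega>)"
    using intDw by (intro integral_cong_AE) (auto intro!: determined_measurable_M[OF D] borel_measurable_times)
  also have "\<dots> = expectation (\<lambda>\<omega>. D \<omega> * indicator ?U \<omega>)"
    using intDU determined_measurable[OF D, of borel] U by (intro F.real_cond_exp_intg(2)) auto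
  finally have *: "expectation (\<lambda>\<omega>. D \<omega> * indicator ?U \<omega>) = expectation (\<lambda>\<omega>. D \<omega> * up_prob n \<omega>)" ..
  have "expectation (\<lambda>\<omega>. if X (Suc n) \<omega> = X n \<omega> + 1 then Z1 \<omega> else Z2 \<omega>) =
      expectation (\<lambda>\<omega>. D \<omega> * indicator ?U \<omega> + Z2 \<omega>)"
    by (rule Bochner_Integration.integral_cong) (auto simp: D_def)
  also have "\<dots> = expectation (\<lambda>\<omega>. D \<omega> * up_prob n \<omega> + Z2 \<omega>)"
    using intDU intDw intZ2 * by simp
  also have "\<dots> = expectation (\<lambda>\<omega>. up_prob n \<omega> * Z1 \<omega> + (1 - up_prob n \<omega>) * Z2 \<omega>)"
    by (rule Bochner_Integration.integral_cong) (auto simp: D_def algebra_simps)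
  finally show ?thesis .
qed

text \<open>The form in which the supermartingale arguments use the step law: \<open>V\<close> is
  the next value, dominated by \<open>Z1\<close> after a right step and by \<open>Z2\<close> after a
  left step, and \<open>W\<close> is the current value plus any permitted drift.\<close>

lemma expectation_step_le:
  fixes Z1 Z2 Z V :: "'a \<Rightarrow> real"
  assumes Z: "determined n Z1" "determined n Z2" "\<And>\<omega>. \<bar>Z1 \<omega>\<bar> \<le> B" "\<And>\<omega>. \<bar>Z2 \<omega>\<bar> \<le> B"
    and V: "integrable M V" "AE \<omega> in M. V \<omega> \<le> (if X (Suc n) \<omega> = X n \<omega> + 1 then Z1 \<omega> else Z2 \<omega>)"
    and W: "integrable M W" "\<And>\<omega>. up_prob n \<omega> * Z1 \<omega> + (1 - up_prob n \<omega>) * Z2 \<omega> \<le> W \<omega>"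
  shows "expectation V \<le> expectation W"
proof -
  note [measurable] = X_measurable determined_measurable_M[OF Z(1)] determined_measurable_M[OF Z(2)]
  have "expectation V \<le> expectation (\<lambda>\<omega>. if X (Suc n) \<omega> = X n \<omega> + 1 then Z1 \<omega> else Z2 \<omega>)"
    using Z(3,4) by (intro integral_mono_AE V integrable_const_bound[of _ B]) auto
  also have "\<dots> = expectation (\<lambda>\<omega>. up_prob n \<omega> * Z1 \<omega> + (1 - up_prob n \<omega>) * Z2 \<omega>)"
    by (rule expectation_step[OF Z])
  also have "\<dots> \<le> expectation W"
  proof (intro integral_mono W determined_integrable)
    show "determined n (\<lambda>\<omega>. up_prob n \<omega> * Z1 \<omega> + (1 - up_prob n \<omega>) * Z2 \<omega>)"
    proof (rule determinedI)
      fix \<omega> \<omega>' assume "\<And>m. m \<le> n \<Longrightarrow> X m \<omega> = X m \<omega>'" "\<And>m. m \<le> n \<Longrightarrow> Y m \<omega> = Y m \<omega>'"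
      then have "up_prob n \<omega> = up_prob n \<omega>'" "Z1 \<omega> = Z1 \<omega>'" "Z2 \<omega> = Z2 \<omega>'"
        using determinedD[OF determined_up_prob] determinedD[OF Z(1)] determinedD[OF Z(2)] by blast+
      then show "up_prob n \<omega> * Z1 \<omega> + (1 - up_prob n \<omega>) * Z2 \<omega> =
          up_prob n \<omega>' * Z1 \<omega>' + (1 - up_prob n \<omega>') * Z2 \<omega>'" by simp
    qed
    fix \<omega>
    have "\<bar>up_prob n \<omega> * Z1 \<omega>\<bar> \<le> 1 * B" "\<bar>(1 - up_prob n \<omega>) * Z2 \<omega>\<bar> \<le> 1 * B"
      unfolding abs_mult using Z(3,4)[of \<omega>] up_prob_bounds[of n \<omega>] p_less_1
      by (intro mult_mono; simp)+
    then show "\<bar>up_prob n \<omega> * Z1 \<omega> + (1 - up_prob n \<omega>) * Z2 \<omega>\<bar> \<le> 2 * B" by linarith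
  qed
  finally show ?thesis .
qed

lemma AE_path:
  "AE \<omega> in M. X 0 \<omega> = 0 \<and> (\<forall>n. X (Suc n) \<omega> = X n \<omega> + 1 \<or> X (Suc n) \<omega> = X n \<omega> - 1)"
proof -
  have "AE \<omega> in M. \<forall>n. X (Suc n) \<omega> - X n \<omega> \<in> {-1, 1}"
    unfolding AE_all_countable using X_step by blast
  then show ?thesis
    using start
  proof eventually_elim
    case (elim \<omega>)
    then have "X (Suc n) \<omega> - X n \<omega> = -1 \<or> X (Suc n) \<omega> - X n \<omega> = 1" for n by blast
    then show ?case using elim by (smt (verit))
  qed
qed

end

text \<open>The generators of the sigma-algebra are symmetric in the two walks, so estimates proved
  for one walk transfer to the other.\<close>

lemma right_biased_merw_swap:
  assumes "right_biased_merw M p X Y"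
  shows "right_biased_merw M p Y X"
proof -
  interpret right_biased_merw M p X Y by fact
  have F: "natural_sigma M Y X n = natural_sigma M X Y n" for n
    unfolding natural_sigma_def by (simp add: Un_commute)
  have indep: "AE \<omega> in M.
      prob_given M (natural_sigma M X Y n)
          (\<lambda>\<omega>. Y (Suc n) \<omega> - Y n \<omega> \<in> A \<and> X (Suc n) \<omega> - X n \<omega> \<in> B) \<omega>
        = prob_given M (natural_sigma M X Y n) (\<lambda>\<omega>. Y (Suc n) \<omega> - Y n \<omega> \<in> A) \<omega>
          * prob_given M (natural_sigma M X Y n) (\<lambda>\<omega>. X (Suc n) \<omega> - X n \<omega> \<in> B) \<omega>" for n A B
    using steps_cond_indep[of n B A] by (simp add: mult.commute conj_commute)
  have start': "AE \<omega> in M. Y 0 \<omega> = 0 \<and> X 0 \<omega> = 0"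
    using start by (simp add: conj_commute)
  show ?thesis
    by (unfold_locales, unfold F)
      (rule X_measurable Y_measurable X_step Y_step X_up Y_up start' indep half_less_p p_less_1)+
qed

section \<open>Hitting and backtracking estimates\<close>

context right_biased_merw
begin

text \<open>Optional stopping for an exponential of the distance to \<open>l\<close>. As
  \<open>X T\<close> is at least \<open>- T\<close>, the initial value falls short of 1 by at most
  \<open>(T + l) * \<epsilon>\<close>; a path without a hit contributes at most
  \<open>1 / \<kappa> ^ N\<close> at the end. \<open>\<epsilon>\<close> stays free, to be tuned to
  \<open>T\<close> and \<open>N\<close>.\<close>

lemma prob_no_hit_le:
  fixes T N :: nat and l :: int and \<epsilon> :: real
  assumes \<epsilon>: "0 < \<epsilon>" "\<epsilon> < 1" and l: "0 \<le> l" and N: "0 < N"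
  shows "prob {\<omega> \<in> space M. \<forall>m\<in>{T..T + N}. X m \<omega> < l} \<le> (real T + of_int l) * \<epsilon> + 2 / (N * \<epsilon>\<^sup>2)"
proof -
  define b where "b = 1 - \<epsilon>"
  have b: "0 < b" "b < 1" using \<epsilon> by (auto simp: b_def)
  define \<kappa> where "\<kappa> = (b + 1 / b) / 2"
  have "b + 1 / b - 2 = \<epsilon>\<^sup>2 / b"
    using b by (simp add: field_simps power2_eq_square) (simp add: b_def algebra_simps)
  moreover have "\<epsilon>\<^sup>2 \<le> \<epsilon>\<^sup>2 / b" using b mult_right_mono[of b 1 "\<epsilon>\<^sup>2"] by (simp add: field_simps)
  ultimately have \<kappa>: "1 + \<epsilon>\<^sup>2 / 2 \<le> \<kappa>" by (simp add: \<kappa>_def)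
  then have \<kappa>1: "1 \<le> \<kappa>" using zero_le_power2[of \<epsilon>] by linarith
  \<comment> \<open>Linear growth of \<open>\<kappa> ^ N\<close> is enough for polynomial error
    bounds.\<close>
  have "1 + real N * (\<epsilon>\<^sup>2 / 2) \<le> (1 + \<epsilon>\<^sup>2 / 2) ^ N"
    by (rule Bernoulli_inequality) (use zero_le_power2[of \<epsilon>] in linarith)
  also have "\<dots> \<le> \<kappa> ^ N" using \<kappa> by (intro power_mono) auto
  finally have "real N * \<epsilon>\<^sup>2 / 2 \<le> \<kappa> ^ N" by simp
  then have \<kappa>N: "1 / \<kappa> ^ N \<le> 2 / (N * \<epsilon>\<^sup>2)"
    using \<epsilon> N frac_le[of 1 1 "real N * \<epsilon>\<^sup>2 / 2" "\<kappa> ^ N"] by simp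
  define hit where "hit i \<omega> \<longleftrightarrow> (\<exists>m\<in>{T..T + i}. l \<le> X m \<omega>)" for i \<omega>
  \<comment> \<open>The normalization by \<open>\<kappa>\<close> makes \<open>b ^ (l - X) / \<kappa> ^ i\<close> a martingale for the unbiased walk.\<close>
  define V where "V i \<omega> = (if hit i \<omega> then 1 else b ^ nat (l - X (T + i) \<omega>) / \<kappa> ^ i)" for i \<omega>
  have hit_cong: "hit i \<omega> = hit i \<omega>'" if "\<And>m. m \<le> T + i \<Longrightarrow> X m \<omega> = X m \<omega>'" for i \<omega> \<omega>'
    unfolding hit_def using that by (intro bex_cong) auto
  have det_hit: "determined (T + i) (hit i)" for i
    by (rule determinedI) (rule hit_cong)
  have det: "determined (T + i) (V i)" for i
  proof (rule determinedI)
    fix \<omega> \<omega>' assume *: "\<And>m. m \<le> T + i \<Longrightarrow> X m \<omega> = X m \<omega>'"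
    show "V i \<omega> = V i \<omega>'"
      using hit_cong[of i \<omega> \<omega>', OF *] *[of "T + i"] by (simp add: V_def)
  qed
  have pow_le: "b ^ j / \<kappa> ^ i \<le> 1" for i j
    using b one_le_power[OF \<kappa>1, of i] power_le_one[of b j] by (simp add: divide_le_eq)
  have V0: "0 \<le> V i \<omega>" for i \<omega> using b \<kappa>1 by (simp add: V_def)
  have V1: "V i \<omega> \<le> 1" for i \<omega> using pow_le by (simp add: V_def)
  have int: "integrable M (V i)" for i
    using V0 V1 by (intro determined_integrable[OF det, of _ 1]) simp
  have mono: "expectation (V i) \<le> expectation (V (Suc i))" for i
  proof -
    define Z where "Z s \<omega> = (if hit i \<omega> then 1 else b ^ nat (l - X (T + i) \<omega> - s) / \<kappa> ^ Suc i)" for s \<omega>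
    have Zdet: "determined (T + i) (\<lambda>\<omega>. - Z s \<omega>)" for s
    proof (rule determinedI)
      fix \<omega> \<omega>' assume *: "\<And>m. m \<le> T + i \<Longrightarrow> X m \<omega> = X m \<omega>'"
      show "- Z s \<omega> = - Z s \<omega>'"
        using hit_cong[of i \<omega> \<omega>', OF *] *[of "T + i"] by (simp add: Z_def)
    qed
    have ZB: "\<bar>- Z s \<omega>\<bar> \<le> 1" for s \<omega>
    proof -
      have "0 \<le> Z s \<omega>" "Z s \<omega> \<le> 1" using b \<kappa>1 pow_le[of _ "Suc i"] by (simp_all add: Z_def)
      then show ?thesis by simp
    qed
    \<comment> \<open>\<open>V\<close> is a submartingale, so the one-step criterion is applied to
      \<open>- V\<close>.\<close>
    have "expectation (\<lambda>\<omega>. - V (Suc i) \<omega>) \<le> expectation (\<lambda>\<omega>. - V i \<omega>)"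
    proof (rule expectation_step_le[where n = "T + i", OF Zdet Zdet ZB ZB])
      show "AE \<omega> in M. - V (Suc i) \<omega> \<le> (if X (Suc (T + i)) \<omega> = X (T + i) \<omega> + 1 then - Z 1 \<omega> else - Z (-1) \<omega>)"
        using AE_path
      proof eventually_elim
        case (elim \<omega>)
        then have step: "X (Suc (T + i)) \<omega> = X (T + i) \<omega> + 1 \<or> X (Suc (T + i)) \<omega> = X (T + i) \<omega> - 1"
          by blast
        have hit_Suc: "hit (Suc i) \<omega> \<longleftrightarrow> hit i \<omega> \<or> l \<le> X (Suc (T + i)) \<omega>"
          by (auto simp: hit_def atLeastAtMostSuc_conv)
        show ?case
        proof (cases "hit (Suc i) \<omega>")
          case True
          then have "V (Suc i) \<omega> = 1" by (simp add: V_def)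
          then show ?thesis using ZB[of _ \<omega>] by (auto simp: abs_le_iff)
        next
          case False
          then have "V (Suc i) \<omega> = Z (X (Suc (T + i)) \<omega> - X (T + i) \<omega>) \<omega>"
            using hit_Suc by (simp add: V_def Z_def)
          then show ?thesis using step by auto
        qed
      qed
      fix \<omega>
      show "up_prob (T + i) \<omega> * - Z 1 \<omega> + (1 - up_prob (T + i) \<omega>) * - Z (-1) \<omega> \<le> - V i \<omega>"
      proof (cases "hit i \<omega>")
        case True
        then show ?thesis by (simp add: Z_def V_def)
      next
        case False
        \<comment> \<open>Before the hit the distance to \<open>l\<close> is positive, so the
          truncation in \<open>nat\<close> is inactive at both neighbours too.\<close>
        then have "\<not> l \<le> X (T + i) \<omega>" unfolding hit_def by fastforce
        then obtain k where k: "nat (l - X (T + i) \<omega>) = Suc k" "nat (l - X (T + i) \<omega> - 1) = k"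
            "nat (l - X (T + i) \<omega> + 1) = Suc (Suc k)"
          by (intro that[of "nat (l - X (T + i) \<omega> - 1)"]) auto
        have Zk: "Z 1 \<omega> = b ^ k / \<kappa> ^ Suc i" "Z (-1) \<omega> = b ^ Suc (Suc k) / \<kappa> ^ Suc i"
          using False k by (simp_all add: Z_def)
        have "b ^ k * (b * b) \<le> b ^ k * 1"
          using b by (intro mult_left_mono) (auto intro: mult_le_one)
        then have "Z (-1) \<omega> \<le> Z 1 \<omega>"
          unfolding Zk using \<kappa>1 by (intro divide_right_mono) (auto simp: mult_ac)
        \<comment> \<open>The bias can only help: this product is the excess of the average over its
          value at probability \<open>1 / 2\<close>.\<close>
        then have "0 \<le> (up_prob (T + i) \<omega> - 1 / 2) * (Z 1 \<omega> - Z (-1) \<omega>)"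
          using up_prob_bounds(1)[of "T + i" \<omega>] by (intro mult_nonneg_nonneg) auto
        moreover have "V i \<omega> = (Z 1 \<omega> + Z (-1) \<omega>) / 2"
        proof -
          have "1 + b * b = 2 * b * \<kappa>" using b by (simp add: \<kappa>_def field_simps)
          then have "b ^ k * (1 + b * b) = 2 * b ^ Suc k * \<kappa>" by simp
          then have "Z 1 \<omega> + Z (-1) \<omega> = 2 * b ^ Suc k * \<kappa> / \<kappa> ^ Suc i"
            unfolding Zk add_divide_distrib[symmetric] by (simp add: algebra_simps)
          also have "\<dots> = 2 * V i \<omega>" using False k \<kappa>1 by (simp add: V_def)
          finally show ?thesis by simp
        qed
        ultimately show ?thesis by (simp add: algebra_simps)
      qed
    qed (use int in auto)
    then show ?thesis using int by simp
  qed
  have mono0: "expectation (V 0) \<le> expectation (V i)" for i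
    by (induction i) (auto intro: order_trans mono)
  let ?H = "{\<omega> \<in> space M. \<forall>m\<in>{T..T + N}. X m \<omega> < l}"
  have H: "?H = {\<omega> \<in> space M. \<not> hit N \<omega>}" by (auto simp: hit_def not_le)
  have "determined (T + N) (\<lambda>\<omega>. \<not> hit N \<omega>)" using det_hit[of N] by (simp add: determined_def)
  then have Hm: "?H \<in> sets M" unfolding H by (rule determined_event)
  have int_H: "integrable M (indicator ?H :: 'a \<Rightarrow> real)"
    using Hm by (intro integrable_real_indicator) (auto simp: emeasure_eq_measure)
  have "1 - (real T + of_int l) * \<epsilon> \<le> expectation (V 0)"
  proof -
    have "AE \<omega> in M. 1 - (real T + of_int l) * \<epsilon> \<le> V 0 \<omega>"
      using AE_path
    proof eventually_elim
      case (elim \<omega>)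
      have "- int n \<le> X n \<omega>" for n
      proof (induction n)
        case (Suc n)
        moreover have "X (Suc n) \<omega> = X n \<omega> + 1 \<or> X (Suc n) \<omega> = X n \<omega> - 1" using elim by blast
        ultimately show ?case by auto
      qed (use elim in simp)
      from this[of T] have "nat (l - X T \<omega>) \<le> T + nat l" using l by linarith
      then have "b ^ (T + nat l) \<le> b ^ nat (l - X T \<omega>)" using b by (intro power_decreasing) auto
      also have "\<dots> \<le> V 0 \<omega>" using b by (simp add: V_def power_le_one)
      finally have "b ^ (T + nat l) \<le> V 0 \<omega>" .
      moreover have "1 + real (T + nat l) * (- \<epsilon>) \<le> (1 + (- \<epsilon>)) ^ (T + nat l)"
        by (rule Bernoulli_inequality) (use \<epsilon> in simp)
      ultimately show ?case using l by (simp add: b_def)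
    qed
    then have "expectation (\<lambda>_. 1 - (real T + of_int l) * \<epsilon>) \<le> expectation (V 0)"
      using int by (intro integral_mono_AE) auto
    then show ?thesis by (simp add: prob_space)
  qed
  also have "\<dots> \<le> expectation (V N)" by (rule mono0)
  also have "\<dots> \<le> expectation (\<lambda>\<omega>. (1 - indicator ?H \<omega>) + 1 / \<kappa> ^ N)"
  proof (rule integral_mono)
    show "V N \<omega> \<le> (1 - indicator ?H \<omega>) + 1 / \<kappa> ^ N" if "\<omega> \<in> space M" for \<omega>
      using that b \<kappa>1 unfolding H
      by (auto simp: V_def indicator_def intro!: divide_right_mono power_le_one)
    show "integrable M (\<lambda>\<omega>. (1 - indicator ?H \<omega>) + 1 / \<kappa> ^ N)"
      by (intro int_H Bochner_Integration.integrable_add Bochner_Integration.integrable_diff integrable_const)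
  qed (use int in auto)
  also have "\<dots> = 1 - prob ?H + 1 / \<kappa> ^ N"
    using Hm int_H by (simp add: prob_space)
  finally show ?thesis using \<kappa>N by linarith
qed

text \<open>The constant \<open>b\<close> of \<open>revisit_potential\<close> for
  \<open>r = (1 - p) / p\<close>: the largest value of \<open>q + (1 - q) * r\<close> over
  right-step probabilities \<open>q\<close> up to \<open>p\<close>.\<close>

definition decay :: real where
  "decay = p + (1 - p) * ((1 - p) / p)"

lemma left_right_ratio: "0 < (1 - p) / p" "(1 - p) / p < 1"
  using half_less_p p_less_1 by (auto simp: field_simps)

lemma decay_bounds: "0 < decay" "decay < 1"
proof -
  have "(1 - p) * ((1 - p) / p) < (1 - p) * 1"
    using left_right_ratio p_less_1 by (intro mult_strict_left_mono) auto
  then show "decay < 1" by (simp add: decay_def)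
  have "0 \<le> (1 - p) * ((1 - p) / p)" using half_less_p by (simp flip: power2_eq_square)
  then show "0 < decay" using half_less_p unfolding decay_def by linarith
qed

lemma determined_revisits:
  "determined n (\<lambda>\<omega>. f (revisited (\<lambda>m. X m \<omega>) n l) (top_site (\<lambda>m. X m \<omega>) n))"
proof (rule determinedI)
  fix \<omega> \<omega>' assume *: "\<And>m. m \<le> n \<Longrightarrow> X m \<omega> = X m \<omega>'"
  show "f (revisited (\<lambda>m. X m \<omega>) n l) (top_site (\<lambda>m. X m \<omega>) n) =
      f (revisited (\<lambda>m. X m \<omega>') n l) (top_site (\<lambda>m. X m \<omega>') n)"
    using revisit_potential_cong(3)[of n "\<lambda>m. X m \<omega>" "\<lambda>m. X m \<omega>'" l]
      top_site_cong[of n "\<lambda>m. X m \<omega>" "\<lambda>m. X m \<omega>'"] * by simp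
qed

text \<open>The potential starts at 1 and does not increase in expectation. Once the maximum has
  reached \<open>l\<close>, \<open>settled\<close> vanishes and the potential is the power on the
  left divided by \<open>decay ^ nat l\<close>. The base is the one that
  \<open>escape_potential\<close> will need.\<close>

lemma expectation_revisited_le:
  assumes l: "0 \<le> l"
  shows "expectation (\<lambda>\<omega>. of_bool (l \<le> top_site (\<lambda>m. X m \<omega>) T) *
      ((1 - p) / p) ^ card (revisited (\<lambda>m. X m \<omega>) T l)) \<le> decay ^ nat l"
proof -
  define r where "r = (1 - p) / p"
  have r: "0 < r" "r < 1" using left_right_ratio by (auto simp: r_def)
  define Z where "Z n \<omega> = revisit_potential r decay l (\<lambda>m. X m \<omega>) n" for n \<omega>
  define B where "B = 1 / decay ^ Suc (nat l)"
  have Z0: "0 \<le> Z n \<omega>" for n \<omega>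
    using r decay_bounds by (simp add: Z_def revisit_potential_nonneg)
  have ZB: "Z n \<omega> \<le> B" for n \<omega>
    using r decay_bounds by (simp add: Z_def B_def revisit_potential_le del: power_Suc)
  have det: "determined n (Z n)" for n
    unfolding Z_def by (intro determinedI revisit_potential_cong(1))
  have int: "integrable M (Z n)" for n
    using Z0 ZB by (intro determined_integrable[OF det, of _ B]) simp
  have mono: "expectation (Z (Suc n)) \<le> expectation (Z n)" for n
  proof -
    define F where "F \<omega> \<longleftrightarrow> fresh l (\<lambda>m. X m \<omega>) n" for \<omega>
    have detF: "determined n F"
      unfolding F_def by (intro determinedI revisit_potential_cong(2))
    define Z' where "Z' s \<omega> = (if F \<omega> then s / decay else 1) * Z n \<omega>" for s \<omega>
    have det': "determined n (Z' s)" for s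
    proof (rule determinedI)
      fix \<omega> \<omega>' assume "\<And>m. m \<le> n \<Longrightarrow> X m \<omega> = X m \<omega>'" "\<And>m. m \<le> n \<Longrightarrow> Y m \<omega> = Y m \<omega>'"
      then have "F \<omega> = F \<omega>'" "Z n \<omega> = Z n \<omega>'"
        using determinedD[OF det] determinedD[OF detF] by blast+
      then show "Z' s \<omega> = Z' s \<omega>'" by (simp add: Z'_def)
    qed
    have B': "\<bar>Z' s \<omega>\<bar> \<le> 1 / decay * B" if "0 \<le> s" "s \<le> 1" for s \<omega>
    proof -
      have "1 \<le> 1 / decay" "0 \<le> s / decay" "s / decay \<le> 1 / decay"
        using decay_bounds that by (simp_all add: divide_right_mono)
      then show ?thesis
        unfolding Z'_def abs_mult using Z0[of n \<omega>] ZB[of n \<omega>] decay_bounds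
        by (intro mult_mono) auto
    qed
    show ?thesis
    proof (rule expectation_step_le[where n = n, OF det' det' B' B'])
      show "AE \<omega> in M. Z (Suc n) \<omega> \<le> (if X (Suc n) \<omega> = X n \<omega> + 1 then Z' 1 \<omega> else Z' r \<omega>)"
        using AE_path
      proof eventually_elim
        case (elim \<omega>)
        then show ?case
          using revisit_potential_Suc[of r decay "\<lambda>m. X m \<omega>" n l] r decay_bounds
          by (auto simp: Z_def Z'_def F_def split: if_splits)
      qed
      fix \<omega>
      \<comment> \<open>A left step, which earns the factor \<open>r\<close>, is least likely when
        the step probability is \<open>p\<close>.\<close>
      have "0 \<le> (p - up_prob n \<omega>) * (1 - r)"
        using r up_prob_bounds[of n \<omega>] by (intro mult_nonneg_nonneg) auto
      then have "up_prob n \<omega> + (1 - up_prob n \<omega>) * r \<le> decay"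
        by (simp add: decay_def algebra_simps flip: r_def)
      then have "(up_prob n \<omega> + (1 - up_prob n \<omega>) * r) / decay * Z n \<omega> \<le> 1 * Z n \<omega>"
        using Z0 decay_bounds by (intro mult_right_mono) auto
      then show "up_prob n \<omega> * Z' 1 \<omega> + (1 - up_prob n \<omega>) * Z' r \<omega> \<le> Z n \<omega>"
        by (simp add: Z'_def divide_inverse algebra_simps)
    qed (use r int in auto)
  qed
  \<comment> \<open>At time 0 the path is fresh or \<open>l\<close> is 0; either way
    \<open>settled\<close> is 0 and both exponents vanish.\<close>
  have "AE \<omega> in M. Z 0 \<omega> = 1"
    using AE_path
  proof eventually_elim
    case (elim \<omega>)
    then have "top_site (\<lambda>m. X m \<omega>) 0 = 0" by (simp add: top_site_def)
    moreover have "visits (\<lambda>m. X m \<omega>) 0 j \<le> 1" for j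
    proof -
      have "card {m. m \<le> 0 \<and> X m \<omega> = j} \<le> card {0::nat}" by (rule card_mono) auto
      then show ?thesis by (simp add: visits_def)
    qed
    moreover have "revisited (\<lambda>m. X m \<omega>) 0 0 = {}" by (auto simp: revisited_def)
    ultimately show ?case
      using elim l by (simp add: Z_def revisit_potential_def settled_def fresh_def
          less_Suc_eq_le numeral_2_eq_2)
  qed
  then have E0: "expectation (Z 0) = 1"
    using integral_cong_AE[of "Z 0" M "\<lambda>_. 1"] int[of 0] by (simp add: prob_space)
  have ET: "expectation (Z n) \<le> 1" for n
    by (induction n) (auto simp: E0 intro: order_trans[OF mono])
  have "expectation (\<lambda>\<omega>. of_bool (l \<le> top_site (\<lambda>m. X m \<omega>) T) *
      r ^ card (revisited (\<lambda>m. X m \<omega>) T l)) \<le> expectation (\<lambda>\<omega>. decay ^ nat l * Z T \<omega>)"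
  proof (rule integral_mono)
    show "integrable M (\<lambda>\<omega>. of_bool (l \<le> top_site (\<lambda>m. X m \<omega>) T) *
        r ^ card (revisited (\<lambda>m. X m \<omega>) T l))"
    proof (rule determined_integrable)
      show "\<bar>of_bool (l \<le> top_site (\<lambda>m. X m \<omega>) T) * r ^ card (revisited (\<lambda>m. X m \<omega>) T l)\<bar> \<le> 1" for \<omega>
        using r by (simp add: power_le_one)
    qed (rule determined_revisits)
    show "of_bool (l \<le> top_site (\<lambda>m. X m \<omega>) T) * r ^ card (revisited (\<lambda>m. X m \<omega>) T l)
        \<le> decay ^ nat l * Z T \<omega>" for \<omega>
      using r decay_bounds Z0[of T \<omega>]
      by (cases "l \<le> top_site (\<lambda>m. X m \<omega>) T")
        (simp_all add: Z_def revisit_potential_def settled_def min_absorb2)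
  qed (use int in simp)
  also have "\<dots> \<le> decay ^ nat l"
    using ET[of T] decay_bounds by (simp add: mult_left_le)
  finally show ?thesis unfolding r_def .
qed

end

section \<open>Backtracking from a high site\<close>

context right_biased_merw
begin

text \<open>The set \<open>D\<close> of sites revisited by \<open>Y\<close> is frozen at time
  \<open>T\<close>: its sites keep weight \<open>p\<close> afterwards and all others have weight at
  least \<open>1 / 2\<close>. The escape potential of \<open>X\<close> then gains little per step,
  and Markov's inequality with the barrier value at \<open>K\<close> gives the probability. Charging
  one gain to every time step avoids counting the returns to \<open>l\<close>.\<close>

lemma prob_backtrack_le:
  fixes T N :: nat and K l :: int
  assumes K: "0 \<le> K" "K < l"
  shows "prob {\<omega> \<in> space M. l \<le> top_site (\<lambda>m. Y m \<omega>) T \<and>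
      (\<exists>n\<in>{T..T + N}. (\<exists>m\<in>{T..n}. l \<le> X m \<omega>) \<and> X n \<omega> \<le> K)} * ((1 - p) / p) ^ nat (K + 1)
    \<le> N * decay ^ nat l"
proof -
  interpret swap: right_biased_merw M p Y X
    by (rule right_biased_merw_swap) (rule right_biased_merw_axioms)
  define r where "r = (1 - p) / p"
  have r: "0 < r" "r < 1" using left_right_ratio by (auto simp: r_def)
  define D where "D \<omega> = revisited (\<lambda>m. Y m \<omega>) T l" for \<omega>
  define G where "G \<omega> \<longleftrightarrow> l \<le> top_site (\<lambda>m. Y m \<omega>) T" for \<omega>
  define armed where "armed i \<omega> \<longleftrightarrow> (\<exists>m\<in>{T..T + i}. l \<le> X m \<omega>)" for i \<omega>
  define dead where "dead i \<omega> \<longleftrightarrow> (\<exists>n\<in>{T..T + i}. (\<exists>m\<in>{T..n}. l \<le> X m \<omega>) \<and> X n \<omega> \<le> K)" for i \<omega>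
  define \<phi> where "\<phi> \<omega> = escape_potential r (D \<omega>) K l" for \<omega>
  \<comment> \<open>\<open>W\<close> increases in expectation by at most \<open>R\<close> per step: only a visit to \<open>l\<close> can raise it.\<close>
  define W where "W i \<omega> = (if \<not> G \<omega> then 0 else if dead i \<omega> then \<phi> \<omega> K
      else if armed i \<omega> then \<phi> \<omega> (X (T + i) \<omega>) else 0)" for i \<omega>
  define R where "R \<omega> = of_bool (G \<omega>) * r ^ card (D \<omega>)" for \<omega>
  define B where "B = real (nat (l - K))"
  have cong: "D \<omega> = D \<omega>'" "G \<omega> = G \<omega>'" "armed i \<omega> = armed i \<omega>'" "dead i \<omega> = dead i \<omega>'"
      "\<phi> \<omega> = \<phi> \<omega>'" "X (T + i) \<omega> = X (T + i) \<omega>'" "W i \<omega> = W i \<omega>'" "R \<omega> = R \<omega>'"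
    if X: "\<And>m. m \<le> T + i \<Longrightarrow> X m \<omega> = X m \<omega>'" and Y: "\<And>m. m \<le> T + i \<Longrightarrow> Y m \<omega> = Y m \<omega>'"
    for i \<omega> \<omega>'
  proof -
    show D: "D \<omega> = D \<omega>'" unfolding D_def by (rule revisit_potential_cong(3)) (use Y in auto)
    show G: "G \<omega> = G \<omega>'"
      using top_site_cong[of T "\<lambda>m. Y m \<omega>" "\<lambda>m. Y m \<omega>'"] Y by (simp add: G_def)
    show a: "armed i \<omega> = armed i \<omega>'" unfolding armed_def using X by (intro bex_cong) auto
    show d: "dead i \<omega> = dead i \<omega>'"
      unfolding dead_def using X by (intro bex_cong conj_cong) auto
    show \<phi>: "\<phi> \<omega> = \<phi> \<omega>'" by (simp add: \<phi>_def D)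
    show "X (T + i) \<omega> = X (T + i) \<omega>'" by (rule X) simp
    then show "W i \<omega> = W i \<omega>'" by (simp add: W_def G a d \<phi>)
    show "R \<omega> = R \<omega>'" by (simp add: R_def G D)
  qed
  have \<phi>0: "0 \<le> \<phi> \<omega> x" and \<phi>B: "\<phi> \<omega> x \<le> B" for \<omega> x
    using r by (simp_all add: \<phi>_def B_def escape_potential_nonneg escape_potential_le)
  have W0: "0 \<le> W i \<omega>" and WB: "W i \<omega> \<le> B" for i \<omega>
    using \<phi>0 \<phi>B by (simp_all add: W_def B_def)
  have intW: "integrable M (W i)" for i
    using W0 WB by (intro determined_integrable[of "T + i" _ B] determinedI cong(7)) auto
  have intR: "integrable M R"
    using r by (intro determined_integrable[of "T + 0" _ 1] determinedI cong(8)[of 0]) (auto simp: R_def power_le_one)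
  \<comment> \<open>The revisited sites belong to \<open>Y\<close>, so the moment bound is that of
    the swapped walk.\<close>
  have ER: "expectation R \<le> decay ^ nat l"
    using swap.expectation_revisited_le[of l T] K
    unfolding R_def G_def D_def r_def swap.decay_def decay_def by simp
  have mono: "expectation (W (Suc i)) \<le> expectation (W i) + expectation R" for i
  proof -
    define Z where "Z s \<omega> = (if G \<omega> \<and> armed i \<omega> \<and> \<not> dead i \<omega> then \<phi> \<omega> (X (T + i) \<omega> + s) else W i \<omega>)"
      for s \<omega>
    have det: "determined (T + i) (Z s)" for s
    proof (rule determinedI)
      fix \<omega> \<omega>'
      assume *: "\<And>m. m \<le> T + i \<Longrightarrow> X m \<omega> = X m \<omega>'" "\<And>m. m \<le> T + i \<Longrightarrow> Y m \<omega> = Y m \<omega>'"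
      show "Z s \<omega> = Z s \<omega>'" unfolding Z_def by (simp only: cong(2-7)[OF *])
    qed
    have ZB: "\<bar>Z s \<omega>\<bar> \<le> B" for s \<omega>
      using \<phi>0 \<phi>B W0 WB by (simp add: Z_def)
    have "expectation (W (Suc i)) \<le> expectation (\<lambda>\<omega>. W i \<omega> + R \<omega>)"
    proof (rule expectation_step_le[where n = "T + i", OF det det ZB ZB])
      show "AE \<omega> in M. W (Suc i) \<omega> \<le> (if X (Suc (T + i)) \<omega> = X (T + i) \<omega> + 1 then Z 1 \<omega> else Z (-1) \<omega>)"
        using AE_path
      proof eventually_elim
        case (elim \<omega>)
        then have step: "X (Suc (T + i)) \<omega> = X (T + i) \<omega> + 1 \<or> X (Suc (T + i)) \<omega> = X (T + i) \<omega> - 1"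
          by blast
        have armed_Suc: "armed (Suc i) \<omega> \<longleftrightarrow> armed i \<omega> \<or> l \<le> X (Suc (T + i)) \<omega>"
          by (auto simp: armed_def atLeastAtMostSuc_conv)
        have dead_Suc: "dead (Suc i) \<omega> \<longleftrightarrow> dead i \<omega> \<or> armed (Suc i) \<omega> \<and> X (Suc (T + i)) \<omega> \<le> K"
          by (auto simp: armed_def dead_def atLeastAtMostSuc_conv)
        consider "\<not> G \<omega>" | "G \<omega>" "dead i \<omega>" | "G \<omega>" "\<not> dead i \<omega>" "armed i \<omega>"
          | "G \<omega>" "\<not> dead i \<omega>" "\<not> armed i \<omega>" by blast
        then show ?case
        proof cases
          case 3
          then have "W (Suc i) \<omega> = \<phi> \<omega> (X (Suc (T + i)) \<omega>)"
            using escape_potential_below[of "X (Suc (T + i)) \<omega>" K r "D \<omega>" l]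
            by (simp add: W_def dead_Suc armed_Suc \<phi>_def)
          then show ?thesis using 3 step by (auto simp: Z_def)
        next
          case 4
          \<comment> \<open>Arming happens at or above \<open>l\<close>, where the potential is 0,
            so \<open>W\<close> does not jump.\<close>
          then have "W (Suc i) \<omega> = 0"
            using K by (auto simp: W_def dead_Suc armed_Suc \<phi>_def escape_potential_eq_0)
          then show ?thesis using W0 \<phi>0 by (simp add: Z_def)
        qed (auto simp: W_def Z_def dead_Suc)
      qed
      fix \<omega>
      define q where "q = up_prob (T + i) \<omega>"
      have q: "1 / 2 \<le> q" "q \<le> 1"
        using up_prob_bounds[of "T + i" \<omega>] p_less_1 by (auto simp: q_def)
      show "up_prob (T + i) \<omega> * Z 1 \<omega> + (1 - up_prob (T + i) \<omega>) * Z (-1) \<omega> \<le> W i \<omega> + R \<omega>"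
      proof (cases "G \<omega> \<and> armed i \<omega> \<and> \<not> dead i \<omega>")
        case True
        let ?x = "X (T + i) \<omega>"
        \<comment> \<open>Otherwise \<open>n = T + i\<close> would witness
          \<open>dead\<close>.\<close>
        have "K < ?x" using True unfolding armed_def dead_def by fastforce
        moreover have "1 - q \<le> q * r" if "?x \<in> D \<omega>"
        proof -
          have "2 \<le> visits (\<lambda>m. Y m \<omega>) T ?x" using that by (simp add: D_def revisited_def)
          also have "\<dots> \<le> visits (\<lambda>m. Y m \<omega>) (T + i) ?x" by (rule visits_mono) simp
          finally have "q = p" unfolding q_def by (rule up_prob_revisited)
          then show ?thesis using half_less_p by (simp add: r_def)
        qed
        moreover have "D \<omega> \<subseteq> {0..<l}" by (auto simp: D_def revisited_def)
        ultimately have "q * \<phi> \<omega> (?x + 1) + (1 - q) * \<phi> \<omega> (?x - 1) \<le> \<phi> \<omega> ?x + r ^ card (D \<omega>)"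
          unfolding \<phi>_def using r K q by (intro escape_potential_drift) auto
        then show ?thesis using True by (simp add: Z_def W_def R_def q_def)
      next
        case False
        then have "Z s \<omega> = W i \<omega>" for s by (auto simp: Z_def)
        moreover have "0 \<le> R \<omega>" using r by (simp add: R_def)
        ultimately show ?thesis by (simp add: algebra_simps)
      qed
    qed (use intW intR in auto)
    then show ?thesis using intW intR by simp
  qed
  \<comment> \<open>At time \<open>T\<close> an armed path is at or above \<open>l\<close>, hence
    not dead and of potential 0.\<close>
  have "W 0 = (\<lambda>\<omega>. 0)"
    using K by (intro ext) (auto simp: W_def dead_def armed_def \<phi>_def escape_potential_eq_0)
  then have "expectation (W i) \<le> i * expectation R" for i
    by (induction i) (auto intro: order_trans[OF mono] simp: algebra_simps)
  also have "\<dots> i \<le> i * decay ^ nat l" for i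
    using ER by (intro mult_left_mono) auto
  finally have EW: "expectation (W N) \<le> N * decay ^ nat l" .
  let ?E = "{\<omega> \<in> space M. G \<omega> \<and> dead N \<omega>}"
  have "determined (T + N) (\<lambda>\<omega>. G \<omega> \<and> dead N \<omega>)"
    by (intro determinedI arg_cong2[where f = "(\<and>)"] cong(2,4)[of N])
  then have E: "?E \<in> sets M" by (rule determined_event)
  have int_E: "integrable M (indicator ?E :: 'a \<Rightarrow> real)"
    using E by (intro integrable_real_indicator) (auto simp: emeasure_eq_measure)
  have "prob ?E * r ^ nat (K + 1) = expectation (\<lambda>\<omega>. indicator ?E \<omega> * r ^ nat (K + 1))"
    using E by simp
  also have "\<dots> \<le> expectation (W N)"
  proof (rule integral_mono)
    fix \<omega> assume "\<omega> \<in> space M"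
    have "r ^ nat (K + 1) \<le> \<phi> \<omega> K"
      unfolding \<phi>_def using r K by (intro escape_potential_barrier) (auto simp: D_def revisited_def)
    then show "indicator ?E \<omega> * r ^ nat (K + 1) \<le> W N \<omega>"
      using W0[of N \<omega>] by (auto simp: W_def indicator_def)
  qed (use intW int_E in simp_all)
  also note EW
  finally show ?thesis unfolding G_def dead_def r_def .
qed

end

section \<open>Transience along a sequence of scales\<close>

text \<open>Time \<open>scale k ^ 8\<close> suffices to reach \<open>scale k\<close> from the origin; as \<open>scale\<close> is cubed at each step,
  \<open>scale k ^ 24\<close> and \<open>scale k ^ 72\<close> are the corresponding times for \<open>k + 1\<close> and \<open>k + 2\<close>.\<close>

definition scale :: "nat \<Rightarrow> nat" where
  "scale k = 2 ^ 3 ^ k"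

lemma scale_Suc: "scale (Suc k) = scale k ^ 3"
  by (simp add: scale_def mult.commute flip: power_mult)

lemma scale_ge: "2 ^ k \<le> scale k" "2 \<le> scale k"
proof -
  have "k < 2 ^ k" by (rule less_exp)
  also have "(2::nat) ^ k \<le> 3 ^ k" by (rule power_mono) auto
  finally have "k \<le> 3 ^ k" "1 \<le> (3::nat) ^ k" by auto
  then show "2 ^ k \<le> scale k" "2 \<le> scale k"
    unfolding scale_def using power_increasing[of 1 "3 ^ k" "2::nat"] by auto
qed

text \<open>This is the \<open>j\<close>-th power of the sequence \<open>n * c ^ n\<close> with
  \<open>c = root j b\<close>.\<close>

lemma power_times_geometric_tendsto_0:
  fixes b :: real
  assumes "0 < b" "b < 1" "0 < j"
  shows "(\<lambda>n. real n ^ j * b ^ n) \<longlonglongrightarrow> 0"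
proof -
  define c where "c = root j b"
  have c: "c ^ j = b" "0 < c" "c < 1"
    using assms by (auto simp: c_def)
  have "(\<lambda>n. real n * c ^ n) \<longlonglongrightarrow> 0"
    by (rule powser_times_n_limit_0) (use c in simp)
  then have "(\<lambda>n. (real n * c ^ n) ^ j) \<longlonglongrightarrow> 0 ^ j"
    by (rule tendsto_power)
  moreover have "(real n * c ^ n) ^ j = real n ^ j * b ^ n" for n
    by (simp add: power_mult_distrib mult.commute flip: c(1) power_mult)
  ultimately show ?thesis using assms by (simp add: zero_power)
qed

text \<open>The windows from \<open>scale k ^ 24\<close> to \<open>scale k ^ 72\<close> tile the
  late times, as \<open>scale (Suc k) ^ 24 = scale k ^ 72\<close>. For \<open>n\<close> in window
  \<open>k\<close>, the hit granted by \<open>up\<close> comes no later than \<open>n\<close>, and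
  \<open>stay\<close> lasts to the end of the window.\<close>

lemma eventually_above_from_scales:
  fixes x :: "nat \<Rightarrow> int"
  assumes up: "\<And>k. k \<ge> k0 \<Longrightarrow> \<exists>m\<in>{scale k ^ 8..scale k ^ 24}. int (scale k) \<le> x m"
    and stay: "\<And>k m n. k \<ge> k0 \<Longrightarrow> scale k ^ 8 \<le> m \<Longrightarrow> m \<le> n \<Longrightarrow> n \<le> scale k ^ 72 \<Longrightarrow>
      int (scale k) \<le> x m \<Longrightarrow> K < x n"
    and n: "scale k0 ^ 24 \<le> n"
  shows "K < x n"
proof -
  have "n < 2 ^ n" by (rule less_exp)
  also have "\<dots> \<le> scale n" by (rule scale_ge)
  also have "\<dots> \<le> scale n ^ 72" using scale_ge(2)[of n] by (intro self_le_power) auto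
  finally have "n \<le> scale n ^ 72" by simp
  moreover have "scale (max k0 n) ^ 72 \<ge> scale n ^ 72"
    unfolding scale_def by (intro power_mono power_increasing) auto
  ultimately have ex: "\<exists>k. k \<ge> k0 \<and> n \<le> scale k ^ 72"
    by (meson max.cobounded1 order_trans)
  define k where "k = (LEAST k. k \<ge> k0 \<and> n \<le> scale k ^ 72)"
  have k: "k \<ge> k0" "n \<le> scale k ^ 72"
    using LeastI_ex[OF ex] by (auto simp: k_def)
  have "scale k ^ 24 \<le> n"
  proof (cases "k = k0")
    case False
    then obtain j where j: "k = Suc j" "j \<ge> k0" using k(1) by (cases k) auto
    \<comment> \<open>Minimality of \<open>k\<close> places \<open>n\<close> after
      \<open>scale j ^ 72\<close>, the start of window \<open>k\<close>.\<close>
    then have "\<not> n \<le> scale j ^ 72"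
      using not_less_Least[of j "\<lambda>k. k \<ge> k0 \<and> n \<le> scale k ^ 72"] by (auto simp: k_def)
    then show ?thesis by (simp add: j scale_Suc flip: power_mult)
  qed (use n in simp)
  then show ?thesis
    using up[OF k(1)] stay[OF k(1) _ _ k(2)] by (meson atLeastAtMost_iff order_trans)
qed

section \<open>Borel-Cantelli over the scales\<close>

context right_biased_merw
begin

lemma AE_eventually_above:
  fixes K :: int
  assumes K: "0 \<le> K"
  shows "AE \<omega> in M. \<exists>n0. \<forall>n\<ge>n0. K < X n \<omega>"
proof -
  interpret swap: right_biased_merw M p Y X
    by (rule right_biased_merw_swap) (rule right_biased_merw_axioms)
  note [measurable] = X_measurable Y_measurable
  define r where "r = ((1 - p) / p) ^ nat (K + 1)"
  have r: "0 < r" using left_right_ratio by (simp add: r_def)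
  \<comment> \<open>Bad events at scale \<open>k\<close>: \<open>Y\<close> is late in reaching it,
    \<open>X\<close> is late in reaching it after time \<open>scale k ^ 8\<close>, or
    \<open>X\<close> reaches it and falls back to \<open>K\<close>. The time intervals have the
    shape \<open>T..T + N\<close> of the estimates above.\<close>
  define A where "A k = {\<omega> \<in> space M. \<forall>m\<in>{0..0 + scale k ^ 8}. Y m \<omega> < int (scale k)}" for k
  define C where "C k = {\<omega> \<in> space M.
    \<forall>m\<in>{scale k ^ 8..scale k ^ 8 + (scale k ^ 24 - scale k ^ 8)}. X m \<omega> < int (scale k)}" for k
  define E where "E k = {\<omega> \<in> space M. int (scale k) \<le> top_site (\<lambda>m. Y m \<omega>) (scale k ^ 8) \<and>
    (\<exists>n\<in>{scale k ^ 8..scale k ^ 8 + (scale k ^ 72 - scale k ^ 8)}.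
      (\<exists>m\<in>{scale k ^ 8..n}. int (scale k) \<le> X m \<omega>) \<and> X n \<omega> \<le> K)}" for k
  have sets: "A k \<in> sets M" "C k \<in> sets M" "E k \<in> sets M" for k
    unfolding A_def C_def E_def top_site_ge_iff by measurable
  have A: "prob (A k) \<le> 3 * (1 / scale k)" for k
  proof -
    define x where "x = real (scale k)"
    have x: "2 \<le> x" using scale_ge(2)[of k] unfolding x_def by linarith
    \<comment> \<open>With \<open>\<epsilon> = 1 / x ^ 2\<close> the two errors are
      \<open>1 / x\<close> and \<open>2 / x ^ 4\<close>.\<close>
    have "prob (A k) \<le> (real 0 + int (scale k)) * (1 / x ^ 2) + 2 / (real (scale k ^ 8) * (1 / x ^ 2)\<^sup>2)"
      unfolding A_def using x scale_ge(2)[of k] by (intro swap.prob_no_hit_le) auto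
    also have "\<dots> = 1 / x + 2 / x ^ 4"
      using x by (simp add: field_simps flip: x_def power_add power_mult) (simp add: eval_nat_numeral)
    also have "\<dots> \<le> 1 / x + 2 / x"
      using x self_le_power[of x 4] by (intro add_left_mono frac_le) auto
    finally show ?thesis by (simp add: x_def)
  qed
  have C: "prob (C k) \<le> 4 * (1 / scale k)" for k
  proof -
    define x where "x = real (scale k)"
    have x: "2 \<le> x" using scale_ge(2)[of k] unfolding x_def by linarith
    have "x ^ 8 \<le> x ^ 23" "2 * x ^ 23 \<le> x * x ^ 23"
      using x by (auto intro!: power_increasing mult_right_mono)
    then have x24: "x ^ 23 \<le> x ^ 24 - x ^ 8" by (simp add: eval_nat_numeral)
    moreover have "real (scale k ^ 24 - scale k ^ 8) = x ^ 24 - x ^ 8"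
      using scale_ge(2)[of k] by (simp add: x_def of_nat_diff power_increasing)
    ultimately have N: "x ^ 23 \<le> real (scale k ^ 24 - scale k ^ 8)" by simp
    have "0 < x ^ 23" using x by simp
    then have N0: "0 < scale k ^ 24 - scale k ^ 8" using N by linarith
    \<comment> \<open>\<open>\<epsilon> = 1 / x ^ 9\<close> beats the starting time
      \<open>x ^ 8\<close>, while \<open>x ^ 23 * \<epsilon>\<^sup>2\<close> is still
      \<open>x ^ 5\<close>.\<close>
    have "1 < x ^ 9" using x by (intro one_less_power) auto
    then have "prob (C k) \<le> (real (scale k ^ 8) + int (scale k)) * (1 / x ^ 9) +
        2 / (real (scale k ^ 24 - scale k ^ 8) * (1 / x ^ 9)\<^sup>2)"
      unfolding C_def using x N0 by (intro prob_no_hit_le) auto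
    also have "\<dots> \<le> (x ^ 8 + x ^ 8) * (1 / x ^ 9) + 2 / (x ^ 23 * (1 / x ^ 9)\<^sup>2)"
      using x N self_le_power[of x 8]
      by (intro add_mono mult_right_mono divide_left_mono mult_pos_pos) (auto simp: x_def)
    also have "\<dots> = 2 / x + 2 / x ^ 5"
      using x by (simp add: field_simps flip: power_add power_mult) (simp add: eval_nat_numeral)
    also have "\<dots> \<le> 2 / x + 2 / x"
      using x self_le_power[of x 5] by (intro add_left_mono frac_le) auto
    finally show ?thesis by (simp add: x_def)
  qed
  have lim: "filterlim scale at_top sequentially"
    by (rule filterlim_at_top_mono[OF filterlim_ident])
      (auto intro!: always_eventually order_trans[OF less_imp_le[OF less_exp] scale_ge(1)])
  \<comment> \<open>The exponent is 72, from the length of the window, plus one: this leaves a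
    factor \<open>1 / x\<close> for summability.\<close>
  have "eventually (\<lambda>n. real n ^ 73 * decay ^ n < 1) sequentially"
    using power_times_geometric_tendsto_0[OF decay_bounds, of 73]
    by (intro order_tendstoD(2)) auto
  then have ev1: "eventually (\<lambda>k. real (scale k) ^ 73 * decay ^ scale k < 1) sequentially"
    using lim by (rule eventually_compose_filterlim)
  have ev2: "eventually (\<lambda>k. nat K < scale k) sequentially"
    using lim unfolding filterlim_at_top Suc_le_eq[symmetric] by blast
  have "eventually (\<lambda>k. prob (A k \<union> C k \<union> E k) \<le> (7 + 1 / r) * (1 / 2) ^ k) sequentially"
    using ev1 ev2
  proof eventually_elim
    case (elim k)
    define x where "x = real (scale k)"
    have x: "2 \<le> x" using scale_ge(2)[of k] unfolding x_def by linarith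
    have "prob (E k) * r \<le> real (scale k ^ 72 - scale k ^ 8) * decay ^ nat (int (scale k))"
      unfolding E_def r_def using K elim(2) by (intro prob_backtrack_le) auto
    also have "\<dots> \<le> x ^ 72 * decay ^ scale k"
      unfolding x_def of_nat_power[symmetric] using decay_bounds by (intro mult_mono) auto
    also have "\<dots> \<le> 1 / x"
    proof -
      have "x * x ^ 72 = x ^ 73" by (simp add: eval_nat_numeral)
      then have "x * (x ^ 72 * decay ^ scale k) \<le> 1"
        using elim(1) unfolding x_def mult.assoc[symmetric] by simp
      then show ?thesis using x by (simp add: field_simps)
    qed
    finally have "prob (E k) \<le> 1 / r * (1 / scale k)"
      using pos_le_divide_eq[OF r, of "prob (E k)" "1 / x"] by (simp add: x_def mult.commute)
    moreover have "prob (A k \<union> C k \<union> E k) \<le> prob (A k \<union> C k) + prob (E k)"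
      by (intro measure_Un_le sets.Un sets)
    moreover have "prob (A k \<union> C k) \<le> prob (A k) + prob (C k)"
      by (intro measure_Un_le sets)
    \<comment> \<open>The constant collects 3 from \<open>A\<close>, 4 from \<open>C\<close> and
      \<open>1 / r\<close> from \<open>E\<close>.\<close>
    ultimately have "prob (A k \<union> C k \<union> E k) \<le> (7 + 1 / r) * (1 / scale k)"
      using A[of k] C[of k] unfolding distrib_right by linarith
    also have "\<dots> \<le> (7 + 1 / r) * (1 / 2) ^ k"
    proof (rule mult_left_mono)
      have "(2::real) ^ k \<le> real (scale k)"
        using scale_ge(1)[of k] by (metis of_nat_le_iff of_nat_numeral of_nat_power)
      then show "1 / real (scale k) \<le> (1 / 2) ^ k"
        by (simp add: power_one_over frac_le)
    qed (use r in simp)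
    finally show ?case .
  qed
  then have "eventually (\<lambda>k. norm (prob (A k \<union> C k \<union> E k)) \<le> (7 + 1 / r) * (1 / 2) ^ k) sequentially"
    by simp
  moreover have "summable (\<lambda>k. (7 + 1 / r) * (1 / 2) ^ k)"
    by (intro summable_mult summable_geometric) simp
  ultimately have "summable (\<lambda>k. prob (A k \<union> C k \<union> E k))"
    by (rule summable_comparison_test_ev)
  moreover have "emeasure M (A k \<union> C k \<union> E k) < \<infinity>" for k
    by (simp add: emeasure_eq_measure)
  ultimately have "AE \<omega> in M. eventually (\<lambda>k. \<omega> \<in> space M - (A k \<union> C k \<union> E k)) sequentially"
    by (intro borel_cantelli_AE1 sets.Un sets)
  then show ?thesis
  proof eventually_elim
    case (elim \<omega>)
    then obtain k0 where k0: "\<And>k. k \<ge> k0 \<Longrightarrow> \<omega> \<in> space M - (A k \<union> C k \<union> E k)"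
      by (auto simp: eventually_sequentially)
    have le: "scale k ^ 8 \<le> scale k ^ 24" "scale k ^ 8 \<le> scale k ^ 72" for k
      using scale_ge(2)[of k] by (auto intro!: power_increasing)
    have "K < X n \<omega>" if "scale k0 ^ 24 \<le> n" for n
    proof (rule eventually_above_from_scales[OF _ _ that])
      fix k assume k: "k \<ge> k0"
      show "\<exists>m\<in>{scale k ^ 8..scale k ^ 24}. int (scale k) \<le> X m \<omega>"
        using k0[OF k] le[of k] by (auto simp: C_def not_less)
      fix m n
      assume mn: "scale k ^ 8 \<le> m" "m \<le> n" "n \<le> scale k ^ 72" "int (scale k) \<le> X m \<omega>"
      \<comment> \<open>Outside \<open>A k\<close> the walk \<open>Y\<close> has arrived in time, so
        a fall of \<open>X\<close> to \<open>K\<close> after its visit to \<open>scale k\<close>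
        would put the path in \<open>E k\<close>.\<close>
      have "int (scale k) \<le> top_site (\<lambda>m. Y m \<omega>) (scale k ^ 8)"
        using k0[OF k] by (auto simp: A_def top_site_ge_iff not_less)
      moreover have "n \<in> {scale k ^ 8..scale k ^ 8 + (scale k ^ 72 - scale k ^ 8)}"
          "m \<in> {scale k ^ 8..n}"
        using mn by auto
      ultimately have "\<omega> \<in> E k" if "X n \<omega> \<le> K"
        using that mn(4) k0[OF k] unfolding E_def by blast
      then show "K < X n \<omega>" using k0[OF k] not_le by blast
    qed
    then show ?case by blast
  qed
qed

lemma transient_X: "transient M X"
proof -
  note [measurable] = X_measurable
  have "AE \<omega> in M. \<forall>K. \<exists>n0. \<forall>n\<ge>n0. int K < X n \<omega>"
    unfolding AE_all_countable using AE_eventually_above by simp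
  then have "AE \<omega> in M. \<forall>z. \<exists>n. \<forall>m>n. X m \<omega> \<noteq> z"
  proof eventually_elim
    case (elim \<omega>)
    show ?case
    proof
      fix z
      \<comment> \<open>The level \<open>nat z\<close> dominates \<open>z\<close> also for negative
        \<open>z\<close>, so natural levels, of which there are countably many, are enough.\<close>
      obtain n0 where "\<forall>n\<ge>n0. int (nat z) < X n \<omega>" using elim by blast
      then have "X m \<omega> \<noteq> z" if "m > n0" for m
        using that by (auto dest!: spec[of _ m] split: if_splits)
      then show "\<exists>n. \<forall>m>n. X m \<omega> \<noteq> z" by blast
    qed
  qed
  moreover have "{\<omega> \<in> space M. \<forall>z. \<exists>n. \<forall>m>n. X m \<omega> \<noteq> z} \<in> sets M"
    by measurable
  ultimately show ?thesis
    unfolding transient_def by (simp add: prob_Collect_eq_1)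
qed

end

theorem proposition3p9:
  fixes M :: "'a measure" and p :: real and X Y :: "nat \<Rightarrow> 'a \<Rightarrow> int"
  assumes "1 / 2 < p" and "p < 1"
    and "mutually_excited_random_walk M p X Y"
  shows "transient M X \<and> transient M Y"
proof -
  have "right_biased_merw M p X Y"
    using assms by (simp add: right_biased_merw_def right_biased_merw_axioms_def)
  then show ?thesis
    using right_biased_merw_swap right_biased_merw.transient_X by blast
qed

end
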